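(* Let $P=\{(x_i,y_j,z_{ij})\in\mathbf{R}^3: i=0,\dots,n;\ j=0,\dots,m\}$ with $x_0<x_1<\dots<x_n$ and $y_0<y_1<\dots<y_m$ be a data set on a rectangular grid, let $E=[x_0,x_n]\times[y_0,y_m]$, and let $\{\mathbf{R}^3; M; W_{ij},\ i=1,\dots,n,\ j=1,\dots,m\}$ be a recurrent iterated function system corresponding to $P$ as specified in the context (with function vertical scaling factors $s_{ij}$, irreducible matrix $M$, and such that the boundary-compatibility conditions (A) and (B) of the context hold for at least one continuous function $g:E\to\mathbf{R}$ interpolating $P$). Let $\mathcal{A}$ be its attractor. Then there exists a function $f:E\to\mathbf{R}$ that interpolates $P$, i.e. $f(x_i,y_j)=z_{ij}$ for all $i=0,\dots,n$, $j=0,\dots,m$, and whose graph is the attractor: $\{(x,y,f(x,y)):(x,y)\in E\}=\mathcal{A}$.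
   Context: **Regions and domains.** Put $N=n\cdot m$, $N_{nm}=\{1,\dots,n\}\times\{1,\dots,m\}$, $I_i=[x_{i-1},x_i]$, $J_j=[y_{j-1},y_j]$, and $E_{ij}=I_i\times J_j$ for $(i,j)\in N_{nm}$ (the *regions* ). Let $l\ge 2$ be an integer. For $k=1,\dots,l$ a *domain* is a rectangle $\tilde E_k=\tilde I_k\times\tilde J_k\subset E$ with $\tilde I_k=[x_{s_x(k)},x_{e_x(k)}]$, $\tilde J_k=[y_{s_y(k)},y_{e_y(k)}]$, where $s_x(k),e_x(k)\in\{0,\dots,n\}$, $s_y(k),e_y(k)\in\{0,\dots,m\}$, $e_x(k)-s_x(k)\ge 2$, $e_y(k)-s_y(k)\ge 2$. Fix a map $\gamma:N_{nm}\to\{1,\dots,l\}$ assigning a domain to each region; below $k=\gamma(i,j)$. **Transformations.** For each $(i,j)\in N_{nm}$ and $k=\gamma(i,j)$: - $L_{x,ij}:[x_{s_x(k)},x_{e_x(k)}]\to[x_{i-1},x_i]$ and $L_{y,ij}:[y_{s_y(k)},y_{e_y(k)}]\to[y_{j-1},y_j]$ are contraction homeomorphisms, with $L_{x,ij}(\{x_{s_x(k)},x_{e_x(k)}\})=\{x_{i-1},x_i\}$ and $L_{y,ij}(\{y_{s_y(k)},y_{e_y(k)}\})=\{y_{j-1},y_j\}$; put $L_{ij}(x,y)=(L_{x,ij}(x),L_{y,ij}(y))$, $L_{ij}:\tilde E_k\to E_{ij}$. - $s_{ij}:E_{ij}\to\mathbf{R}$ (the *vertical scaling factor* ) is a contraction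 mapping (Lipschitz with constant $<1$) with $0<|s_{ij}(x,y)|\le s<1$ for a constant $s$ independent of $(i,j)$. - $Q_{ij}:\tilde E_k\to\mathbf{R}$ is Lipschitz. - $F_{ij}:\tilde E_k\times\mathbf{R}\to\mathbf{R}$, $F_{ij}(x,y,z)=s_{ij}(L_{ij}(x,y))\,z+Q_{ij}(x,y)$. - $W_{ij}:\tilde E_k\times\mathbf{R}\to E_{ij}\times\mathbf{R}$, $W_{ij}(x,y,z)=(L_{ij}(x,y),F_{ij}(x,y,z))$. **Boundary-compatibility assumption.** There exists at least one continuous $g:E\to\mathbf{R}$ with $g(x_i,y_j)=z_{ij}$ for all $i,j$ such that for all $(i,j)\in N_{nm}$, with $k=\gamma(i,j)$: (A) $F_{ij}(x_\alpha,y,g(x_\alpha,y))=g(L_{ij}(x_\alpha,y))$ for $\alpha\in\{s_x(k),e_x(k)\}$ and $y\in[y_{s_y(k)},y_{e_y(k)}]$; (B) $F_{ij}(x,y_\beta,g(x,y_\beta))=g(L_{ij}(x,y_\beta))$ for $\beta\in\{s_y(k),e_y(k)\}$ and $x\in[x_{s_x(k)},x_{e_x(k)}]$. **Recurrent iterated function system (RIFS).** Let $\tau:N_{nm}\to\{1,\dots,N\}$ be the bijection $\tau(i,j)=i+(j-1)n$. Define the row-stochastic matrix $M=(p_{st})_{s,t=1}^N$ by $p_{st}=1/a_s$ if $E_{\tau^{-1}(s)}\subset\tilde E_{\gamma(\tau^{-1}(t))}$ and $p_{st}=0$ otherwise, where $a_s$ is the number of $t\in\{1,\dots,N\}$ with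 $E_{\tau^{-1}(s)}\subset\tilde E_{\gamma(\tau^{-1}(t))}$. It is assumed that $M$ is irreducible. The RIFS corresponding to $P$ is $\{\mathbf{R}^3;M;W_{ij},\ i=1,\dots,n,\ j=1,\dots,m\}$. **Attractor.** The attractor is $\mathcal{A}=\bigcup_{s=1}^N A_s$, where $(A_1,\dots,A_N)$ is the unique $N$-tuple of nonempty compact sets with $A_s\subset E_{\tau^{-1}(s)}\times\mathbf{R}$ and $$A_s=\bigcup_{t:\,p_{ts}>0}W_{\tau^{-1}(s)}(A_t),\qquad s=1,\dots,N.$$ *)

theory Defs
  imports "HOL-Analysis.Analysis"
begin

definition contraction_on :: "'a::metric_space set \<Rightarrow> ('a \<Rightarrow> 'b::metric_space) \<Rightarrow> bool" where
  "contraction_on X f \<longleftrightarrow> (\<exists>c<1. lipschitz_on c X f)"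

definition contraction_homeomorphism ::
    "'a::metric_space set \<Rightarrow> 'b::metric_space set \<Rightarrow> ('a \<Rightarrow> 'b) \<Rightarrow> bool" where
  "contraction_homeomorphism X Y f \<longleftrightarrow>
     contraction_on X f \<and> (\<exists>h. homeomorphism X Y f h)"

definition idx :: "nat \<Rightarrow> nat \<Rightarrow> (nat \<times> nat) set" where
  "idx n m = {1..n} \<times> {1..m}"

definition region :: "(nat \<Rightarrow> real) \<Rightarrow> (nat \<Rightarrow> real) \<Rightarrow> nat \<times> nat \<Rightarrow> (real \<times> real) set" where
  "region x y = (\<lambda>(i, j). {x (i - 1)..x i} \<times> {y (j - 1)..y j})"

definition domain_rect ::
    "(nat \<Rightarrow> real) \<Rightarrow> (nat \<Rightarrow> real) \<Rightarrow> (nat \<Rightarrow> nat) \<Rightarrow> (nat \<Rightarrow> nat) \<Rightarrow> (nat \<Rightarrow> nat) \<Rightarrow> (nat \<Rightarrow> nat)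
      \<Rightarrow> nat \<Rightarrow> (real \<times> real) set" where
  "domain_rect x y sx ex sy ey k = {x (sx k)..x (ex k)} \<times> {y (sy k)..y (ey k)}"

definition L_map ::
    "(nat \<times> nat \<Rightarrow> real \<Rightarrow> real) \<Rightarrow> (nat \<times> nat \<Rightarrow> real \<Rightarrow> real)
      \<Rightarrow> nat \<times> nat \<Rightarrow> real \<times> real \<Rightarrow> real \<times> real" where
  "L_map Lx Ly ij = (\<lambda>(u, v). (Lx ij u, Ly ij v))"

definition F_map ::
    "(nat \<times> nat \<Rightarrow> real \<Rightarrow> real) \<Rightarrow> (nat \<times> nat \<Rightarrow> real \<Rightarrow> real)
      \<Rightarrow> (nat \<times> nat \<Rightarrow> real \<times> real \<Rightarrow> real) \<Rightarrow> (nat \<times> nat \<Rightarrow> real \<times> real \<Rightarrow> real)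
      \<Rightarrow> nat \<times> nat \<Rightarrow> real \<times> real \<times> real \<Rightarrow> real" where
  "F_map Lx Ly S Q ij = (\<lambda>(u, v, w). S ij (L_map Lx Ly ij (u, v)) * w + Q ij (u, v))"

definition W_map ::
    "(nat \<times> nat \<Rightarrow> real \<Rightarrow> real) \<Rightarrow> (nat \<times> nat \<Rightarrow> real \<Rightarrow> real)
      \<Rightarrow> (nat \<times> nat \<Rightarrow> real \<times> real \<Rightarrow> real) \<Rightarrow> (nat \<times> nat \<Rightarrow> real \<times> real \<Rightarrow> real)
      \<Rightarrow> nat \<times> nat \<Rightarrow> real \<times> real \<times> real \<Rightarrow> real \<times> real \<times> real" where
  "W_map Lx Ly S Q ij = (\<lambda>(u, v, w). (Lx ij u, Ly ij v, F_map Lx Ly S Q ij (u, v, w)))"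

definition tau :: "nat \<Rightarrow> nat \<times> nat \<Rightarrow> nat" where
  "tau n = (\<lambda>(i, j). i + (j - 1) * n)"

definition tau_inv :: "nat \<Rightarrow> nat \<Rightarrow> nat \<Rightarrow> nat \<times> nat" where
  "tau_inv n m = inv_into (idx n m) (tau n)"

text \<open>
  In the following, \<open>E\<close> is the family of regions and \<open>D\<close> assigns to every index \<open>(i, j)\<close> the
  domain selected for it. Matrices are indexed by \<open>{1..n * m}\<close>; entries outside that range are
  never used. If no domain contains region \<open>s\<close>, row \<open>s\<close> is zero; irreducibility excludes this,
  and then all rows sum to \<open>1\<close>.
\<close>

definition transition_count ::
    "nat \<Rightarrow> nat \<Rightarrow> (nat \<times> nat \<Rightarrow> (real \<times> real) set) \<Rightarrow> (nat \<times> nat \<Rightarrow> (real \<times> real) set)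
      \<Rightarrow> nat \<Rightarrow> nat" where
  "transition_count n m E D s = card {t \<in> {1..n * m}. E (tau_inv n m s) \<subseteq> D (tau_inv n m t)}"

definition transition_matrix ::
    "nat \<Rightarrow> nat \<Rightarrow> (nat \<times> nat \<Rightarrow> (real \<times> real) set) \<Rightarrow> (nat \<times> nat \<Rightarrow> (real \<times> real) set)
      \<Rightarrow> nat \<Rightarrow> nat \<Rightarrow> real" where
  "transition_matrix n m E D s t =
     (if E (tau_inv n m s) \<subseteq> D (tau_inv n m t) then 1 / real (transition_count n m E D s) else 0)"

text \<open>
  Irreducibility in the form customary for recurrent iterated function systems: for all \<open>s\<close>, \<open>t\<close>
  there is a finite chain \<open>s = i\<^sub>1, \<dots>, i\<^sub>r = t\<close>, \<open>r \<ge> 2\<close>, with all \<open>M i\<^sub>q i\<^sub>q\<^sub>+\<^sub>1\<close> positive.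
\<close>

definition irreducible_matrix :: "nat \<Rightarrow> (nat \<Rightarrow> nat \<Rightarrow> real) \<Rightarrow> bool" where
  "irreducible_matrix N M \<longleftrightarrow>
     (\<forall>s\<in>{1..N}. \<forall>t\<in>{1..N}. (s, t) \<in> {(a, b). a \<in> {1..N} \<and> b \<in> {1..N} \<and> M a b > 0}\<^sup>+)"

definition invariant_tuple ::
    "nat \<Rightarrow> nat \<Rightarrow> (nat \<times> nat \<Rightarrow> (real \<times> real) set) \<Rightarrow> (nat \<Rightarrow> nat \<Rightarrow> real)
      \<Rightarrow> (nat \<times> nat \<Rightarrow> real \<times> real \<times> real \<Rightarrow> real \<times> real \<times> real)
      \<Rightarrow> (nat \<Rightarrow> (real \<times> real \<times> real) set) \<Rightarrow> bool" where
  "invariant_tuple n m E M W A \<longleftrightarrow>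
     (\<forall>s\<in>{1..n * m}.
        A s \<noteq> {} \<and> compact (A s) \<and>
        A s \<subseteq> {(u, v, w). (u, v) \<in> E (tau_inv n m s)} \<and>
        A s = (\<Union>t\<in>{t \<in> {1..n * m}. M t s > 0}. W (tau_inv n m s) ` A t))"

text \<open>
  Tuples are functions that are extensional on \<open>{1..n * m}\<close>, so that uniqueness of the tuple
  is uniqueness of the function.
\<close>

definition attractor ::
    "nat \<Rightarrow> nat \<Rightarrow> (nat \<times> nat \<Rightarrow> (real \<times> real) set) \<Rightarrow> (nat \<Rightarrow> nat \<Rightarrow> real)
      \<Rightarrow> (nat \<times> nat \<Rightarrow> real \<times> real \<times> real \<Rightarrow> real \<times> real \<times> real)
      \<Rightarrow> (real \<times> real \<times> real) set" where
  "attractor n m E M W =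
     (\<Union>s\<in>{1..n * m}. (THE A. A \<in> extensional {1..n * m} \<and> invariant_tuple n m E M W A) s)"

end

theory Submission
  imports Defs
begin

text \<open>
  Let \<open>\<Gamma>\<close> be the union of the grid lines. A map \<open>L\<^sub>i\<^sub>j\<close> sends a point to \<open>\<Gamma>\<close> only if the point lies
  on the boundary of its domain, so for functions \<open>h\<close> that agree with \<open>g\<close> on \<open>\<Gamma>\<close> the compatibility
  conditions make the Read-Bajraktarevic operator
  \<open>h \<mapsto> s\<^sub>i\<^sub>j * h \<circ> L\<^sub>i\<^sub>j\<inverse> + Q\<^sub>i\<^sub>j \<circ> L\<^sub>i\<^sub>j\<inverse>\<close> on \<open>E\<^sub>i\<^sub>j\<close> well defined, and its values again agree with
  \<open>g\<close> on \<open>\<Gamma>\<close>. Its iterates on \<open>g\<close> converge uniformly to a continuous fixed point \<open>f\<close>, and the pieces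
  of the graph of \<open>f\<close> form an invariant tuple.

  For another invariant tuple \<open>A\<close>, the largest vertical distance from a point of \<open>A\<close> to the graph of
  \<open>f\<close> shrinks by the factor \<open>s\<close> under the system, so it is zero and \<open>A\<close> lies on the graph. The largest
  distance from a point of a region to the projection of \<open>A\<close> shrinks as well, because the \<open>L\<^sub>i\<^sub>j\<close> are
  contractions, so the projections fill the regions.
\<close>

section \<open>Maxima over finite families of compact sets\<close>

lemma compact_family_max:
  fixes \<phi> :: "'i \<Rightarrow> 'a::topological_space \<Rightarrow> real"
  assumes "finite I" "I \<noteq> {}"
    and "\<And>a. a \<in> I \<Longrightarrow> compact (K a)" "\<And>a. a \<in> I \<Longrightarrow> K a \<noteq> {}"
    and "\<And>a. a \<in> I \<Longrightarrow> continuous_on (K a) (\<phi> a)"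
  shows "\<exists>a\<in>I. \<exists>p\<in>K a. \<forall>b\<in>I. \<forall>q\<in>K b. \<phi> b q \<le> \<phi> a p"
proof -
  have "\<forall>a\<in>I. \<exists>p. p \<in> K a \<and> (\<forall>q\<in>K a. \<phi> a q \<le> \<phi> a p)"
    using continuous_attains_sup[OF assms(3,4,5)] by blast
  then obtain P where P: "\<And>a. a \<in> I \<Longrightarrow> P a \<in> K a"
    and P_max: "\<And>a q. a \<in> I \<Longrightarrow> q \<in> K a \<Longrightarrow> \<phi> a q \<le> \<phi> a (P a)"
    using bchoice[of I "\<lambda>a p. p \<in> K a \<and> (\<forall>q\<in>K a. \<phi> a q \<le> \<phi> a p)"] by blast
  obtain a where a: "a \<in> I" "Max ((\<lambda>a. \<phi> a (P a)) ` I) = \<phi> a (P a)"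
    using obtains_MAX[OF assms(1,2)] by metis
  have "\<phi> b q \<le> \<phi> a (P a)" if "b \<in> I" "q \<in> K b" for b q
  proof -
    have "\<phi> b (P b) \<le> \<phi> a (P a)"
      unfolding a(2)[symmetric] using assms(1) that(1) by (intro Max_ge) auto
    then show ?thesis using P_max[OF that] by linarith
  qed
  then show ?thesis using a(1) P by blast
qed

text \<open>Let \<open>M\<close> be the largest value taken on the whole family. At a point where it
  is attained, \<open>contr\<close> gives \<open>M\<close> \<le> \<open>c * M\<close> with
  \<open>c < 1\<close>, so \<open>M\<close> \<le> 0. Since \<open>contr\<close> is applied only at
  that point, \<open>c\<close> may vary from point to point and no uniform bound below 1 is
  required.\<close>

lemma contracted_family_zero:
  fixes \<phi> :: "'i \<Rightarrow> 'a::topological_space \<Rightarrow> real"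
  assumes "finite I"
    and "\<And>a. a \<in> I \<Longrightarrow> compact (K a)" "\<And>a. a \<in> I \<Longrightarrow> K a \<noteq> {}"
    and "\<And>a. a \<in> I \<Longrightarrow> continuous_on (K a) (\<phi> a)"
    and nonneg: "\<And>a p. a \<in> I \<Longrightarrow> p \<in> K a \<Longrightarrow> 0 \<le> \<phi> a p"
    and contr: "\<And>a p. a \<in> I \<Longrightarrow> p \<in> K a \<Longrightarrow>
       \<exists>c b q. 0 \<le> c \<and> c < 1 \<and> b \<in> I \<and> q \<in> K b \<and> \<phi> a p \<le> c * \<phi> b q"
    and "a \<in> I" "p \<in> K a"
  shows "\<phi> a p = 0"
proof -
  obtain a0 p0 where max: "a0 \<in> I" "p0 \<in> K a0" "\<And>b q. b \<in> I \<Longrightarrow> q \<in> K b \<Longrightarrow> \<phi> b q \<le> \<phi> a0 p0"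
    using compact_family_max[of I K \<phi>] assms(1-4,7) by blast
  obtain c b q where c: "0 \<le> c" "c < 1" "b \<in> I" "q \<in> K b" "\<phi> a0 p0 \<le> c * \<phi> b q"
    using contr[OF max(1,2)] by blast
  have "\<phi> a0 p0 \<le> c * \<phi> a0 p0"
    using c(5) mult_left_mono[OF max(3)[OF c(3,4)] c(1)] by linarith
  then have "(1 - c) * \<phi> a0 p0 \<le> 0" by (simp add: algebra_simps)
  then have "\<phi> a0 p0 \<le> 0" using c(2) by (simp add: mult_le_0_iff)
  then show ?thesis using max(3)[OF assms(7,8)] nonneg[OF assms(7,8)] by linarith
qed

section \<open>The fixed point of the Read-Bajraktarevic operator\<close>

text \<open>The grid enters only through an abstract set \<Gamma>: it contains every overlap of two
  pieces, and pulling a point of \<Gamma> back along \<open>L a\<close> stays in \<Gamma>, where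
  \<open>g\<close> already solves the functional equation. The operator then preserves continuity
  and the values on \<Gamma>, and it contracts with ratio \<open>s\<close>.\<close>

lemma fractal_function_exists:
  fixes E D :: "'i \<Rightarrow> 'a::metric_space set" and L R :: "'i \<Rightarrow> 'a \<Rightarrow> 'a"
    and S Q :: "'i \<Rightarrow> 'a \<Rightarrow> real" and g :: "'a \<Rightarrow> real"
  assumes fin: "finite I" and X: "X = (\<Union>a\<in>I. E a)"
    and E: "\<And>a. a \<in> I \<Longrightarrow> compact (E a)" and D: "\<And>a. a \<in> I \<Longrightarrow> D a \<subseteq> X"
    and hom: "\<And>a. a \<in> I \<Longrightarrow> homeomorphism (D a) (E a) (L a) (R a)"
    and S: "\<And>a. a \<in> I \<Longrightarrow> continuous_on (E a) (S a)"
    and s: "\<And>a p. a \<in> I \<Longrightarrow> p \<in> E a \<Longrightarrow> \<bar>S a p\<bar> \<le> s" "0 \<le> s" "s < 1"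
    and Q: "\<And>a. a \<in> I \<Longrightarrow> continuous_on (D a) (Q a)"
    and g: "continuous_on X g"
    and overlap: "\<And>a b. a \<in> I \<Longrightarrow> b \<in> I \<Longrightarrow> a \<noteq> b \<Longrightarrow> E a \<inter> E b \<subseteq> \<Gamma>"
    and compat: "\<And>a q. a \<in> I \<Longrightarrow> q \<in> D a \<Longrightarrow> L a q \<in> \<Gamma> \<Longrightarrow>
       q \<in> \<Gamma> \<and> S a (L a q) * g q + Q a q = g (L a q)"
  shows "\<exists>f. continuous_on X f \<and> (\<forall>p\<in>X \<inter> \<Gamma>. f p = g p) \<and>
           (\<forall>a\<in>I. \<forall>q\<in>D a. f (L a q) = S a (L a q) * f q + Q a q)"
proof -
  have "compact X" unfolding X using fin E by blast
  have LE: "L a q \<in> E a" "R a (L a q) = q" if "a \<in> I" "q \<in> D a" for a q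
    using hom[OF that(1)] that(2) by (auto simp: homeomorphism_def)
  have RD: "R a p \<in> D a" "L a (R a p) = p" if "a \<in> I" "p \<in> E a" for a p
    using hom[OF that(1)] that(2) by (auto simp: homeomorphism_def)
  \<comment> \<open>On \<Gamma>, where several pieces may meet, the value \<open>g p\<close> is
    prescribed. At other points of \<open>X\<close> the piece picked by \<open>SOME\<close> is the
    only one containing \<open>p\<close>. Only values on \<open>X\<close> matter.\<close>
  define T where "T h p = (if p \<in> \<Gamma> then g p else
      let a = SOME a. a \<in> I \<and> p \<in> E a in S a p * h (R a p) + Q a (R a p))"
    for h :: "'a \<Rightarrow> real" and p
  define good where "good h \<longleftrightarrow> continuous_on X h \<and> (\<forall>p\<in>X \<inter> \<Gamma>. h p = g p)" for h
  \<comment> \<open>For good \<open>h\<close> the affine formula holds on all of \<open>D a\<close>,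
    including points sent to \<Gamma>: there \<open>h\<close> agrees with \<open>g\<close> at
    \<open>q\<close>, so \<open>compat\<close> turns the formula into
    \<open>g (L a q)\<close>.\<close>
  have T_L: "T h (L a q) = S a (L a q) * h q + Q a q" if "good h" "a \<in> I" "q \<in> D a" for h a q
  proof (cases "L a q \<in> \<Gamma>")
    case True
    then have "q \<in> \<Gamma>" "S a (L a q) * g q + Q a q = g (L a q)" using compat that by blast+
    moreover have "h q = g q" using that D \<open>q \<in> \<Gamma>\<close> unfolding good_def by blast
    ultimately show ?thesis using True by (simp add: T_def)
  next
    case False
    have "(SOME b. b \<in> I \<and> L a q \<in> E b) = a"
    proof (rule some_equality)
      show "a \<in> I \<and> L a q \<in> E a" using LE that by blast
      show "b = a" if "b \<in> I \<and> L a q \<in> E b" for b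
        using overlap[of a b] LE(1)[of a q] False \<open>a \<in> I\<close> \<open>q \<in> D a\<close> that by blast
    qed
    then show ?thesis using False LE(2)[OF that(2,3)] by (simp add: T_def)
  qed
  have T_good: "good (T h)" if h: "good h" for h
  proof -
    \<comment> \<open>By \<open>T_L\<close>, one continuous formula describes \<open>T h\<close> on
      the entire closed piece \<open>E a\<close>, its part in \<Gamma> included. Finitely many
      closed pieces can then be pasted.\<close>
    have "continuous_on (E a) (T h)" if a: "a \<in> I" for a
    proof -
      have R: "continuous_on (E a) (R a)" "R a ` E a \<subseteq> D a"
        using hom[OF a] by (auto simp: homeomorphism_def)
      have "continuous_on (D a) h"
        using h D[OF a] continuous_on_subset unfolding good_def by blast
      then have "continuous_on (E a) (\<lambda>p. S a p * h (R a p) + Q a (R a p))"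
        by (intro continuous_intros S[OF a] continuous_on_compose2[OF _ R] Q[OF a])
      moreover have "S a p * h (R a p) + Q a (R a p) = T h p" if "p \<in> E a" for p
        using T_L[OF h a, of "R a p"] RD[OF a that] by simp
      ultimately show ?thesis by (simp cong: continuous_on_cong)
    qed
    then have "continuous_on X (T h)"
      unfolding X by (intro continuous_on_closed_Union fin compact_imp_closed E)
    then show ?thesis by (simp add: good_def T_def)
  qed
  define H where "H k = (T ^^ k) g" for k
  have H_Suc: "H (Suc k) = T (H k)" for k by (simp add: H_def)
  have H_good: "good (H k)" for k
  proof (induction k)
    case 0
    then show ?case using g by (simp add: H_def good_def)
  next
    case (Suc k)
    then show ?case using T_good by (simp add: H_Suc)
  qed
  have "compact ((\<lambda>p. H 1 p - H 0 p) ` X)"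
    using H_good unfolding good_def
    by (intro compact_continuous_image continuous_intros \<open>compact X\<close>) auto
  then obtain C where C: "\<And>p. p \<in> X \<Longrightarrow> \<bar>H 1 p - H 0 p\<bar> \<le> C"
    using compact_imp_bounded[of "(\<lambda>p. H 1 p - H 0 p) ` X"] unfolding bounded_iff by auto
  \<comment> \<open>Writing \<open>p\<close> as \<open>L a q\<close> with \<open>q = R a p\<close>,
    the terms \<open>Q a q\<close> cancel in the difference of two iterates, which leaves the factor
    \<open>S a p\<close>, bounded by \<open>s\<close>. The bound \<open>C\<close> is that of the
    first increment.\<close>
  have step: "\<bar>H (Suc k) p - H k p\<bar> \<le> C * s ^ k" if "p \<in> X" for k p
    using that
  proof (induction k arbitrary: p)
    case 0
    then show ?case using C by simp
  next
    case (Suc k)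
    then obtain a where a: "a \<in> I" "p \<in> E a" unfolding X by blast
    let ?q = "R a p"
    have q: "?q \<in> D a" "L a ?q = p" using RD[OF a] by auto
    have "H (Suc (Suc k)) p - H (Suc k) p = S a p * (H (Suc k) ?q - H k ?q)"
      using T_L[OF H_good[of "Suc k"] a(1) q(1)] T_L[OF H_good[of k] a(1) q(1)]
      unfolding H_Suc q(2) by (simp add: right_diff_distrib)
    then have "\<bar>H (Suc (Suc k)) p - H (Suc k) p\<bar> = \<bar>S a p\<bar> * \<bar>H (Suc k) ?q - H k ?q\<bar>"
      by (simp add: abs_mult)
    also have "\<dots> \<le> s * (C * s ^ k)"
      using s(1)[OF a] s(2) Suc.IH[of ?q] D[OF a(1)] q(1) by (intro mult_mono) auto
    finally show ?case by (simp add: mult_ac)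
  qed
  have sum_H: "(\<Sum>k<r. H (Suc k) p - H k p) = H r p - g p" for r p
    unfolding sum_lessThan_telescope[of "\<lambda>k. H k p"] by (simp add: H_def)
  \<comment> \<open>The increments telescope to \<open>H r p - g p\<close> and are dominated by a
    geometric series, so the M-test gives uniform convergence; adding \<open>g\<close> back yields
    the limit \<open>f\<close> of the iterates.\<close>
  have "uniform_limit X (\<lambda>r p. \<Sum>k<r. H (Suc k) p - H k p) (\<lambda>p. \<Sum>k. H (Suc k) p - H k p) sequentially"
    using step s(2,3) by (intro Weierstrass_m_test[where M = "\<lambda>k. C * s ^ k"]) (auto intro: summable_mult)
  then obtain d where d: "uniform_limit X (\<lambda>r p. H r p - g p) d sequentially"
    unfolding sum_H by blast
  define f where "f p = d p + g p" for p
  have "uniform_limit X (\<lambda>r p. (H r p - g p) + g p) f sequentially"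
    unfolding f_def by (intro uniform_limit_add d uniform_limit_const)
  then have lim: "uniform_limit X H f sequentially" by simp
  have lim_p: "(\<lambda>r. H r p) \<longlonglongrightarrow> f p" if "p \<in> X" for p
    using tendsto_uniform_limitI[OF lim that] .
  have "continuous_on X f"
    using H_good by (intro uniform_limit_theorem[OF _ lim]) (auto simp: good_def)
  moreover have "f p = g p" if "p \<in> X \<inter> \<Gamma>" for p
  proof -
    have "H r p = g p" for r using H_good[of r] that by (simp add: good_def)
    then show ?thesis using lim_p[of p] that by (simp add: LIMSEQ_const_iff)
  qed
  \<comment> \<open>Both sides are limits of the same sequence, since \<open>H (Suc r)\<close> is
    \<open>T\<close> applied to \<open>H r\<close> and \<open>T_L\<close> evaluates it at
    \<open>L a q\<close>.\<close>
  moreover have "f (L a q) = S a (L a q) * f q + Q a q" if "a \<in> I" "q \<in> D a" for a q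
  proof (rule LIMSEQ_unique)
    have "L a q \<in> X" "q \<in> X" using that LE(1)[OF that] D[OF that(1)] unfolding X by auto
    show "(\<lambda>r. H (Suc r) (L a q)) \<longlonglongrightarrow> f (L a q)"
      using lim_p[OF \<open>L a q \<in> X\<close>] by (rule LIMSEQ_Suc)
    show "(\<lambda>r. H (Suc r) (L a q)) \<longlonglongrightarrow> S a (L a q) * f q + Q a q"
      unfolding H_Suc T_L[OF H_good that] by (intro tendsto_intros lim_p[OF \<open>q \<in> X\<close>])
  qed
  ultimately show ?thesis by blast
qed

section \<open>Invariant subsets of regions fill the regions\<close>

text \<open>The distance from a point of \<open>E a\<close> to \<open>B a\<close> contracts: write
  the point as \<open>L a q\<close> with \<open>q\<close> in some \<open>E b\<close>, take a point
  of \<open>B b\<close> nearest to \<open>q\<close>, and move it by \<open>L a\<close> into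
  \<open>B a\<close>. By \<open>contracted_family_zero\<close> all these distances vanish, and
  \<open>B a\<close> is closed.\<close>

lemma contractions_cover:
  fixes E D B :: "'i \<Rightarrow> 'a::heine_borel set"
  assumes "finite I"
    and E: "\<And>a. a \<in> I \<Longrightarrow> compact (E a)"
    and B: "\<And>a. a \<in> I \<Longrightarrow> compact (B a)" "\<And>a. a \<in> I \<Longrightarrow> B a \<noteq> {}" "\<And>a. a \<in> I \<Longrightarrow> B a \<subseteq> E a"
    and J: "\<And>a. a \<in> I \<Longrightarrow> J a \<subseteq> I" "\<And>a b. a \<in> I \<Longrightarrow> b \<in> J a \<Longrightarrow> E b \<subseteq> D a"
    and contr: "\<And>a. a \<in> I \<Longrightarrow> contraction_on (D a) (L a)"
    and cover: "\<And>a p. a \<in> I \<Longrightarrow> p \<in> E a \<Longrightarrow> \<exists>b\<in>J a. \<exists>q\<in>E b. p = L a q"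
    and inv: "\<And>a b. a \<in> I \<Longrightarrow> b \<in> J a \<Longrightarrow> L a ` B b \<subseteq> B a"
    and "a \<in> I"
  shows "B a = E a"
proof
  show "E a \<subseteq> B a"
  proof
    fix p assume p: "p \<in> E a"
    have E_ne: "E a \<noteq> {}" if "a \<in> I" for a using B(2,3)[OF that] by blast
    have "infdist p (B a) = 0"
    proof (rule contracted_family_zero[where I = I and K = E and \<phi> = "\<lambda>a p. infdist p (B a)"])
      fix a p assume a: "a \<in> I" "p \<in> E a"
      then obtain b q where b: "b \<in> J a" "q \<in> E b" "p = L a q" using cover by blast
      then have "b \<in> I" using J(1)[OF a(1)] by blast
      obtain c where c: "c < 1" "c-lipschitz_on (D a) (L a)"
        using contr[OF a(1)] unfolding contraction_on_def by blast
      obtain q' where q': "q' \<in> B b" "infdist q (B b) = dist q q'"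
        using infdist_attains_inf[of "B b" q] compact_imp_closed[OF B(1)] B(2) \<open>b \<in> I\<close> by metis
      have D: "q \<in> D a" "q' \<in> D a" using J(2)[OF a(1) b(1)] B(3)[OF \<open>b \<in> I\<close>] b(2) q'(1) by auto
      have "infdist p (B a) \<le> dist p (L a q')"
        using inv[OF a(1) b(1)] q'(1) by (intro infdist_le) auto
      also have "\<dots> \<le> c * infdist q (B b)"
        unfolding b(3) q'(2) by (rule lipschitz_onD[OF c(2) D])
      finally show "\<exists>c b q. 0 \<le> c \<and> c < 1 \<and> b \<in> I \<and> q \<in> E b \<and> infdist p (B a) \<le> c * infdist q (B b)"
        using c(1) lipschitz_on_nonneg[OF c(2)] \<open>b \<in> I\<close> b(2) by blast
    qed (use \<open>finite I\<close> E E_ne \<open>a \<in> I\<close> p in \<open>simp_all add: continuous_on_infdist continuous_on_id infdist_nonneg\<close>)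
    then show "p \<in> B a"
      using in_closed_iff_infdist_zero[OF compact_imp_closed[OF B(1)] B(2)] \<open>a \<in> I\<close> by blast
  qed
qed (use B \<open>a \<in> I\<close> in blast)

section \<open>Numbering of the regions and the transition matrix\<close>

text \<open>The inverse is division with remainder by \<open>n\<close>; the shifts by 1 arise
  because rows, columns and numbers all start at 1.\<close>

lemma bij_betw_tau: "bij_betw (tau n) (idx n m) {1..n * m}"
proof (rule bij_betw_byWitness[where f' = "\<lambda>s. ((s - 1) mod n + 1, (s - 1) div n + 1)"])
  show "\<forall>ij\<in>idx n m. ((tau n ij - 1) mod n + 1, (tau n ij - 1) div n + 1) = ij"
  proof
    fix ij assume ij: "ij \<in> idx n m"
    then have "fst ij - 1 < n" "ij = (Suc (fst ij - 1), Suc (snd ij - 1))"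
      by (auto simp: idx_def)
    \<comment> \<open>With indices counted from 0, \<open>tau n ij - 1\<close> becomes
      \<open>a + b * n\<close> with \<open>a < n\<close>, whose remainder and quotient can be read
      off.\<close>
    then obtain a b where ab: "a < n" "ij = (Suc a, Suc b)" by metis
    show "((tau n ij - 1) mod n + 1, (tau n ij - 1) div n + 1) = ij"
      unfolding ab(2) using ab(1) by (simp add: tau_def)
  qed
  show "\<forall>s\<in>{1..n * m}. tau n ((s - 1) mod n + 1, (s - 1) div n + 1) = s"
  proof
    fix s assume "s \<in> {1..n * m}"
    then show "tau n ((s - 1) mod n + 1, (s - 1) div n + 1) = s"
      using mod_div_mult_eq[of "s - 1" n] unfolding tau_def by auto
  qed
  show "tau n ` idx n m \<subseteq> {1..n * m}"
  proof
    fix s assume "s \<in> tau n ` idx n m"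
    then obtain i j where ij: "s = i + (j - 1) * n" "1 \<le> i" "i \<le> n" "1 \<le> j" "j \<le> m"
      by (auto simp: tau_def idx_def)
    have "s \<le> n + (j - 1) * n" using ij by simp
    also have "\<dots> = j * n" using ij(4) by (cases j) auto
    also have "\<dots> \<le> n * m" using ij(5) by (simp add: mult.commute)
    finally show "s \<in> {1..n * m}" using ij by simp
  qed
  show "(\<lambda>s. ((s - 1) mod n + 1, (s - 1) div n + 1)) ` {1..n * m} \<subseteq> idx n m"
  proof (clarsimp simp: idx_def)
    fix s assume "Suc 0 \<le> s" "s \<le> n * m"
    then have "0 < n" "s - Suc 0 < m * n" by (auto intro: Nat.gr0I simp: mult.commute)
    then show "Suc ((s - Suc 0) mod n) \<le> n \<and> Suc ((s - Suc 0) div n) \<le> m"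
      using less_mult_imp_div_less by (simp add: Suc_leI)
  qed
qed

lemma bij_betw_tau_inv: "bij_betw (tau_inv n m) {1..n * m} (idx n m)"
  unfolding tau_inv_def by (rule bij_betw_inv_into[OF bij_betw_tau])

text \<open>If the inclusion holds, \<open>t\<close> itself is among the indices counted, so the
  denominator is not 0 and the entry is positive.\<close>

lemma transition_matrix_pos_iff:
  assumes "t \<in> {1..n * m}"
  shows "transition_matrix n m E D s t > 0 \<longleftrightarrow> E (tau_inv n m s) \<subseteq> D (tau_inv n m t)"
proof -
  have "transition_count n m E D s > 0" if "E (tau_inv n m s) \<subseteq> D (tau_inv n m t)"
    using assms that unfolding transition_count_def by (auto simp: card_gt_0_iff)
  then show ?thesis by (auto simp: transition_matrix_def)
qed

lemma W_map_eq:
  "W_map Lx Ly S Q a (fst q, snd q, w) =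
     (fst (L_map Lx Ly a q), snd (L_map Lx Ly a q), S a (L_map Lx Ly a q) * w + Q a q)"
  by (cases q) (simp add: W_map_def L_map_def F_map_def)

section \<open>Invariant tuples are the pieces of the graph\<close>

text \<open>The equivalence supplies at once the existence and the uniqueness that the definite
  description in \<open>attractor\<close> calls for. The functional equation makes the graph pieces
  invariant; conversely, contraction in the vertical direction and then in the plane forces any
  invariant tuple to be these pieces.\<close>

lemma invariant_tuple_iff_graph:
  fixes n m :: nat and E D :: "nat \<times> nat \<Rightarrow> (real \<times> real) set" and f :: "real \<times> real \<Rightarrow> real"
  defines "G \<equiv> \<lambda>f s. (\<lambda>p. (fst p, snd p, f p)) ` E (tau_inv n m s)"
  assumes E: "\<And>a. a \<in> idx n m \<Longrightarrow> compact (E a)" "\<And>a. a \<in> idx n m \<Longrightarrow> E a \<noteq> {}"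
    and L: "\<And>a. a \<in> idx n m \<Longrightarrow> contraction_on (D a) (L_map Lx Ly a)"
      "\<And>a. a \<in> idx n m \<Longrightarrow> L_map Lx Ly a ` D a = E a"
    and cover: "\<And>a q. a \<in> idx n m \<Longrightarrow> q \<in> D a \<Longrightarrow> \<exists>b\<in>idx n m. q \<in> E b \<and> E b \<subseteq> D a"
    and \<rho>: "\<And>a p. a \<in> idx n m \<Longrightarrow> p \<in> E a \<Longrightarrow> \<bar>S a p\<bar> \<le> \<rho>" "0 \<le> \<rho>" "\<rho> < 1"
    and f: "\<And>a. a \<in> idx n m \<Longrightarrow> continuous_on (E a) f"
    and f_eq: "\<And>a q. a \<in> idx n m \<Longrightarrow> q \<in> D a \<Longrightarrow>
       f (L_map Lx Ly a q) = S a (L_map Lx Ly a q) * f q + Q a q"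
  shows "invariant_tuple n m E (transition_matrix n m E D) (W_map Lx Ly S Q) A \<longleftrightarrow>
           (\<forall>s\<in>{1..n * m}. A s = G f s)"
proof -
  define r where "r = tau_inv n m"
  define I where "I = {1..n * m}"
  \<comment> \<open>In the matrix the source is the row and the target the column:
    \<open>J s\<close> collects the \<open>t\<close> with positive entry at \<open>(t, s)\<close>,
    that is, the regions lying in the domain of region \<open>s\<close>.\<close>
  define J where "J s = {t \<in> I. E (r t) \<subseteq> D (r s)}" for s
  define L where "L = L_map Lx Ly"
  define W where "W = W_map Lx Ly S Q"
  have r: "r s \<in> idx n m" if "s \<in> I" for s
    using bij_betwE[OF bij_betw_tau_inv] that unfolding r_def I_def by blast
  have r_onto: "\<exists>s\<in>I. r s = b" if "b \<in> idx n m" for b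
    using bij_betw_imp_surj_on[OF bij_betw_tau_inv] that unfolding r_def I_def by (metis imageE)
  have inv_iff: "invariant_tuple n m E (transition_matrix n m E D) W A \<longleftrightarrow>
      (\<forall>s\<in>I. A s \<noteq> {} \<and> compact (A s) \<and> A s \<subseteq> {(u, v, w). (u, v) \<in> E (r s)} \<and>
        A s = (\<Union>t\<in>J s. W (r s) ` A t))" for A
  proof -
    have "{t \<in> {1..n * m}. transition_matrix n m E D t s > 0} = J s" if "s \<in> I" for s
      using that by (auto simp: transition_matrix_pos_iff J_def I_def r_def)
    then show ?thesis unfolding invariant_tuple_def by (simp add: I_def r_def)
  qed
  \<comment> \<open>A preimage of \<open>p\<close> in the domain lies in a region contained in that
    domain, because domains are unions of regions.\<close>
  have cover_r: "\<exists>t\<in>J s. \<exists>q\<in>E (r t). p = L (r s) q" if sp: "s \<in> I" "p \<in> E (r s)" for s p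
  proof -
    obtain q where q: "q \<in> D (r s)" "p = L (r s) q"
      using L(2)[OF r[OF sp(1)]] sp(2) unfolding L_def by blast
    obtain b where "b \<in> idx n m" "q \<in> E b" "E b \<subseteq> D (r s)"
      using cover[OF r[OF sp(1)] q(1)] by blast
    then show ?thesis using r_onto[of b] q(2) unfolding J_def by blast
  qed
  have L_E: "L (r s) q \<in> E (r s)" if "s \<in> I" "t \<in> J s" "q \<in> E (r t)" for s t q
    using L(2)[OF r[OF that(1)]] that unfolding J_def L_def by blast
  have W_graph: "W (r s) (fst q, snd q, f q) = (fst (L (r s) q), snd (L (r s) q), f (L (r s) q))"
    if "s \<in> I" "t \<in> J s" "q \<in> E (r t)" for s t q
    using f_eq[OF r[OF that(1)], of q] that unfolding W_def L_def W_map_eq J_def by auto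
  have W_L: "W a (fst q, snd q, w) = (fst (L a q), snd (L a q), S a (L a q) * w + Q a q)" for a q w
    unfolding W_def L_def by (rule W_map_eq)
  have "invariant_tuple n m E (transition_matrix n m E D) W A"
    if A: "\<forall>s\<in>I. A s = G f s"
  proof -
    have "G f s = (\<Union>t\<in>J s. W (r s) ` G f t)" if s: "s \<in> I" for s
    proof
      show "G f s \<subseteq> (\<Union>t\<in>J s. W (r s) ` G f t)"
      proof
        fix P assume "P \<in> G f s"
        then obtain p where p: "p \<in> E (r s)" "P = (fst p, snd p, f p)" by (auto simp: G_def r_def)
        obtain t q where t: "t \<in> J s" "q \<in> E (r t)" "p = L (r s) q" using cover_r[OF s p(1)] by blast
        have "P = W (r s) (fst q, snd q, f q)" using p(2) t W_graph[OF s] by simp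
        moreover have "(fst q, snd q, f q) \<in> G f t" using t(2) by (auto simp: G_def r_def)
        ultimately show "P \<in> (\<Union>t\<in>J s. W (r s) ` G f t)" using t(1) by blast
      qed
      show "(\<Union>t\<in>J s. W (r s) ` G f t) \<subseteq> G f s"
      proof (intro UN_least image_subsetI)
        fix t P assume t: "t \<in> J s" "P \<in> G f t"
        then obtain q where q: "q \<in> E (r t)" "P = (fst q, snd q, f q)"
          by (auto simp: G_def r_def)
        show "W (r s) P \<in> G f s"
          unfolding q(2) W_graph[OF s t(1) q(1)] using L_E[OF s t(1) q(1)]
          by (auto simp: G_def r_def)
      qed
    qed
    moreover have "compact (G f s)" if "s \<in> I" for s
      unfolding G_def using E(1)[OF r[OF that]] f[OF r[OF that]] unfolding r_def
      by (intro compact_continuous_image continuous_intros)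
    moreover have "G f s \<noteq> {}" "G f s \<subseteq> {(u, v, w). (u, v) \<in> E (r s)}" if "s \<in> I" for s
      using E(2)[OF r[OF that]] by (auto simp: G_def r_def)
    ultimately have "G f s \<noteq> {} \<and> compact (G f s) \<and> G f s \<subseteq> {(u, v, w). (u, v) \<in> E (r s)} \<and>
        G f s = (\<Union>t\<in>J s. W (r s) ` G f t)" if "s \<in> I" for s
      using that by blast
    moreover have A_J: "(\<Union>t\<in>J s. W (r s) ` A t) = (\<Union>t\<in>J s. W (r s) ` G f t)" for s
      using A by (intro SUP_cong) (auto simp: J_def)
    moreover have "A s = G f s" if "s \<in> I" for s using A that by blast
    ultimately show ?thesis unfolding inv_iff A_J by (metis (no_types, lifting))
  qed
  moreover have "A s = G f s"
    if "invariant_tuple n m E (transition_matrix n m E D) W A" and s: "s \<in> I" for s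
  proof -
    let ?pr = "\<lambda>P :: real \<times> real \<times> real. (fst P, fst (snd P))"
    have A: "A s \<noteq> {}" "compact (A s)" "A s = (\<Union>t\<in>J s. W (r s) ` A t)" if "s \<in> I" for s
      using \<open>invariant_tuple n m E _ W A\<close> that unfolding inv_iff by blast+
    have A_E: "?pr P \<in> E (r s)" if "s \<in> I" "P \<in> A s" for s P
    proof -
      have "A s \<subseteq> {(u, v, w). (u, v) \<in> E (r s)}"
        using \<open>invariant_tuple n m E _ W A\<close> that(1) unfolding inv_iff by blast
      then show ?thesis using that(2) by auto
    qed
    \<comment> \<open>Vertical deviation from the graph. A point of \<open>A s\<close> is the image
      of a point of some \<open>A t\<close>; since \<open>f\<close> obeys the same affine law as the
      third component of \<open>W\<close>, the \<open>Q\<close> terms cancel and the deviation is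
      multiplied by a value of \<open>S\<close>, at most \<rho> in absolute value.\<close>
    have dev: "\<bar>snd (snd P) - f (?pr P)\<bar> = 0" if "s \<in> I" "P \<in> A s" for s P
    proof (rule contracted_family_zero[where I = I and K = A and
          \<phi> = "\<lambda>_ P. \<bar>snd (snd P) - f (?pr P)\<bar>"])
      fix s assume "s \<in> I"
      show "continuous_on (A s) (\<lambda>P. \<bar>snd (snd P) - f (?pr P)\<bar>)"
        using A_E[OF \<open>s \<in> I\<close>]
        by (intro continuous_intros continuous_on_compose2[OF f[OF r[OF \<open>s \<in> I\<close>]]] image_subsetI)
    next
      fix s P assume "s \<in> I" "P \<in> A s"
      then obtain t P' where P': "t \<in> J s" "P' \<in> A t" "P = W (r s) P'"
        using A(3)[of s] by blast
      define q w where "q = ?pr P'" and "w = snd (snd P')"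
      then have t: "t \<in> J s" "(fst q, snd q, w) \<in> A t" "P = W (r s) (fst q, snd q, w)"
        using P' by simp_all
      have "t \<in> I" using t(1) by (simp add: J_def)
      have q: "q \<in> E (r t)" using A_E[OF \<open>t \<in> I\<close> t(2)] by simp
      have Lq: "L (r s) q \<in> E (r s)" using L_E[OF \<open>s \<in> I\<close> t(1) q] .
      have "f (L (r s) q) = S (r s) (L (r s) q) * f q + Q (r s) q"
        using f_eq[OF r[OF \<open>s \<in> I\<close>], of q] t(1) q unfolding L_def J_def by blast
      then have "snd (snd P) - f (?pr P) = S (r s) (L (r s) q) * (w - f q)"
        unfolding t(3) W_L by (simp add: algebra_simps)
      then have "\<bar>snd (snd P) - f (?pr P)\<bar> = \<bar>S (r s) (L (r s) q)\<bar> * \<bar>w - f q\<bar>"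
        by (simp add: abs_mult)
      also have "\<dots> \<le> \<rho> * \<bar>w - f q\<bar>"
        using \<rho>(1)[OF r[OF \<open>s \<in> I\<close>] Lq] by (intro mult_right_mono) auto
      finally have "\<bar>snd (snd P) - f (?pr P)\<bar> \<le> \<rho> * \<bar>snd (snd (fst q, snd q, w)) - f (?pr (fst q, snd q, w))\<bar>"
        by simp
      then show "\<exists>c b q. 0 \<le> c \<and> c < 1 \<and> b \<in> I \<and> q \<in> A b \<and>
          \<bar>snd (snd P) - f (?pr P)\<bar> \<le> c * \<bar>snd (snd q) - f (?pr q)\<bar>"
        using \<rho>(2,3) \<open>t \<in> I\<close> t(2) by blast
    qed (use A(1,2) that I_def in simp_all)
    \<comment> \<open>The projections form an invariant family for the plane maps, because
      \<open>?pr\<close> intertwines \<open>W (r s)\<close> with \<open>L (r s)\<close>.\<close>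
    have "?pr ` A s = E (r s)"
    proof (rule contractions_cover[where I = I and E = "\<lambda>s. E (r s)" and D = "\<lambda>s. D (r s)"
          and J = J and L = "\<lambda>s. L (r s)" and B = "\<lambda>s. ?pr ` A s"])
      fix s t assume "s \<in> I" "t \<in> J s"
      show "L (r s) ` ?pr ` A t \<subseteq> ?pr ` A s"
      proof (unfold image_image, rule image_subsetI)
        fix P assume "P \<in> A t"
        then have "W (r s) P \<in> A s" using A(3)[OF \<open>s \<in> I\<close>] \<open>t \<in> J s\<close> by blast
        moreover have "L (r s) (?pr P) = ?pr (W (r s) P)"
          using W_L[of "r s" "?pr P" "snd (snd P)"] by simp
        ultimately show "L (r s) (?pr P) \<in> ?pr ` A s" by simp
      qed
    next
      show "compact (?pr ` A s)" if "s \<in> I" for s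
        by (intro compact_continuous_image continuous_intros A(2)[OF that])
    next
      show "?pr ` A s \<subseteq> E (r s)" if "s \<in> I" for s using A_E[OF that] by blast
      show "contraction_on (D (r s)) (L (r s))" if "s \<in> I" for s
        unfolding L_def by (rule L(1)[OF r[OF that]])
      show "E (r t) \<subseteq> D (r s)" if "t \<in> J s" for s t using that by (simp add: J_def)
      show "J s \<subseteq> I" for s by (auto simp: J_def)
    qed (use s A(1) E(1) r cover_r in \<open>simp_all add: I_def\<close>)
    \<comment> \<open>Zero deviation means that each point of \<open>A s\<close> is recovered from
      its projection.\<close>
    moreover have "A s = (\<lambda>p. (fst p, snd p, f p)) ` ?pr ` A s"
    proof -
      have "(\<lambda>P. (fst (?pr P), snd (?pr P), f (?pr P))) ` A s = (\<lambda>P. P) ` A s"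
        using dev[OF s] by (intro image_cong) (auto simp: prod_eq_iff)
      then show ?thesis unfolding image_image by simp
    qed
    ultimately show ?thesis unfolding G_def r_def by simp
  qed
  ultimately show ?thesis unfolding W_def I_def by blast
qed

section \<open>Products of the coordinate maps\<close>

text \<open>Both coordinates contract with the larger of the two constants, which factors out of the
  Euclidean norm.\<close>

lemma contraction_on_L_map:
  assumes "contraction_on X (Lx a)" "contraction_on Y (Ly a)"
  shows "contraction_on (X \<times> Y) (L_map Lx Ly a)"
proof -
  obtain c d where c: "c < 1" "c-lipschitz_on X (Lx a)" and d: "d < 1" "d-lipschitz_on Y (Ly a)"
    using assms unfolding contraction_on_def by blast
  have "(max c d)-lipschitz_on (X \<times> Y) (L_map Lx Ly a)"
  proof (rule lipschitz_onI)
    show nonneg: "0 \<le> max c d" using lipschitz_on_nonneg[OF c(2)] by simp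
    fix p q assume pq: "p \<in> X \<times> Y" "q \<in> X \<times> Y"
    obtain u v u' v' where uv: "p = (u, v)" "q = (u', v')" by fastforce
    have "dist (Lx a u) (Lx a u') \<le> max c d * dist u u'"
      using lipschitz_onD[OF lipschitz_on_le[OF c(2) max.cobounded1]] pq uv by auto
    moreover have "dist (Ly a v) (Ly a v') \<le> max c d * dist v v'"
      using lipschitz_onD[OF lipschitz_on_le[OF d(2) max.cobounded2]] pq uv by auto
    ultimately have "dist (L_map Lx Ly a p) (L_map Lx Ly a q)
        \<le> sqrt ((max c d * dist u u')\<^sup>2 + (max c d * dist v v')\<^sup>2)"
      unfolding uv L_map_def by (simp add: dist_Pair_Pair add_mono power_mono)
    also have "\<dots> = sqrt ((max c d)\<^sup>2 * ((dist u u')\<^sup>2 + (dist v v')\<^sup>2))"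
      by (simp only: power_mult_distrib distrib_left)
    also have "\<dots> = max c d * dist p q"
      unfolding uv dist_Pair_Pair real_sqrt_mult using nonneg by simp
    finally show "dist (L_map Lx Ly a p) (L_map Lx Ly a q) \<le> max c d * dist p q" .
  qed
  then show ?thesis using c(1) d(1) unfolding contraction_on_def by (meson max_less_iff_conj)
qed

lemma homeomorphism_L_map:
  assumes "homeomorphism X X' (Lx a) hx" "homeomorphism Y Y' (Ly a) hy"
  shows "homeomorphism (X \<times> Y) (X' \<times> Y') (L_map Lx Ly a) (\<lambda>p. (hx (fst p), hy (snd p)))"
proof (rule homeomorphismI)
  have cont: "continuous_on X (Lx a)" "continuous_on Y (Ly a)" "continuous_on X' hx" "continuous_on Y' hy"
    using assms by (auto simp: homeomorphism_def)
  have "continuous_on (X \<times> Y) (\<lambda>p. (Lx a (fst p), Ly a (snd p)))"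
    by (intro continuous_intros continuous_on_compose2[OF cont(1)] continuous_on_compose2[OF cont(2)]) auto
  then show "continuous_on (X \<times> Y) (L_map Lx Ly a)" by (simp add: L_map_def case_prod_beta)
  show "continuous_on (X' \<times> Y') (\<lambda>p. (hx (fst p), hy (snd p)))"
    by (intro continuous_intros continuous_on_compose2[OF cont(3)] continuous_on_compose2[OF cont(4)]) auto
qed (use assms in \<open>auto simp: homeomorphism_def L_map_def\<close>)

section \<open>Cells of a one-dimensional grid\<close>

context
  fixes n :: nat and x :: "nat \<Rightarrow> real"
  assumes x: "strict_mono_on {0..n} x"
begin

lemma grid_mono: "i \<le> j \<Longrightarrow> j \<le> n \<Longrightarrow> x i \<le> x j"
  using strict_mono_on_leD[OF x] by simp

text \<open>Induction on the right end: either \<open>u\<close> lies at or before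
  \<open>x b\<close>, or it lies in the last cell. The bounds \<open>a < i\<close> and
  \<open>i \<le> b\<close> place the cell inside the interval from \<open>x a\<close> to
  \<open>x b\<close>.\<close>

lemma grid_cell:
  assumes "a < b" "b \<le> n" "u \<in> {x a..x b}"
  shows "\<exists>i. a < i \<and> i \<le> b \<and> u \<in> {x (i - 1)..x i}"
  using assms
proof (induction b)
  case (Suc b)
  show ?case
  proof (cases "a < b \<and> u \<le> x b")
    case True
    then show ?thesis using Suc by (fastforce intro: le_SucI)
  next
    case False
    then have "u \<in> {x b..x (Suc b)}" using Suc.prems by (cases "a = b") auto
    then show ?thesis using Suc.prems by (intro exI[of _ "Suc b"]) auto
  qed
qed simp

text \<open>For \<open>i < j\<close> the left cell ends at \<open>x i\<close>, which is at most the
  start \<open>x (j - 1)\<close> of the right cell, so a common point equals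
  \<open>x i\<close>.\<close>

lemma grid_cells_overlap:
  assumes "i \<in> {1..n}" "j \<in> {1..n}" "i \<noteq> j" "u \<in> {x (i - 1)..x i}" "u \<in> {x (j - 1)..x j}"
  shows "u \<in> x ` {0..n}"
proof -
  have *: "u \<in> x ` {0..n}"
    if "i < j" "j \<le> n" "u \<le> x i" "x (j - 1) \<le> u" for i j
  proof -
    have "x i \<le> x (j - 1)" using that by (intro grid_mono) auto
    then show ?thesis using that by (intro image_eqI[of _ _ i]) auto
  qed
  show ?thesis using *[of i j] *[of j i] assms by (cases "i < j") auto
qed

lemma grid_point_in_cell:
  assumes "i \<in> {1..n}" "w \<in> x ` {0..n}" "w \<in> {x (i - 1)..x i}"
  shows "w \<in> {x (i - 1), x i}"
proof -
  obtain k where k: "k \<le> n" "w = x k" using assms(2) by auto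
  have "k \<le> i - 1 \<or> i \<le> k" by auto
  then show ?thesis using grid_mono[of k "i - 1"] grid_mono[of i k] k assms(1,3) by fastforce
qed

end

section \<open>Application to the rectangular grid\<close>

theorem theorem1:
  fixes n m l :: nat
    and x y :: "nat \<Rightarrow> real" and z :: "nat \<Rightarrow> nat \<Rightarrow> real"
    and sx ex sy ey :: "nat \<Rightarrow> nat"
    and \<gamma> :: "nat \<times> nat \<Rightarrow> nat"
    and Lx Ly :: "nat \<times> nat \<Rightarrow> real \<Rightarrow> real"
    and S Q :: "nat \<times> nat \<Rightarrow> real \<times> real \<Rightarrow> real"
  assumes "strict_mono_on {0..n} x" and "strict_mono_on {0..m} y"
    and "l \<ge> 2"
    and "\<forall>k\<in>{1..l}. sx k \<in> {0..n} \<and> ex k \<in> {0..n} \<and> sx k + 2 \<le> ex k \<and>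
                     sy k \<in> {0..m} \<and> ey k \<in> {0..m} \<and> sy k + 2 \<le> ey k"
    and "\<gamma> \<in> idx n m \<rightarrow> {1..l}"
    and "\<forall>(i, j)\<in>idx n m. let k = \<gamma> (i, j) in
           contraction_homeomorphism {x (sx k)..x (ex k)} {x (i - 1)..x i} (Lx (i, j)) \<and>
           contraction_homeomorphism {y (sy k)..y (ey k)} {y (j - 1)..y j} (Ly (i, j)) \<and>
           Lx (i, j) ` {x (sx k), x (ex k)} = {x (i - 1), x i} \<and>
           Ly (i, j) ` {y (sy k), y (ey k)} = {y (j - 1), y j}"
    and "\<forall>ij\<in>idx n m. contraction_on (region x y ij) (S ij)"
    and "\<exists>s<1. \<forall>ij\<in>idx n m. \<forall>p\<in>region x y ij. 0 < \<bar>S ij p\<bar> \<and> \<bar>S ij p\<bar> \<le> s"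
    and "\<forall>ij\<in>idx n m. \<exists>C. lipschitz_on C (domain_rect x y sx ex sy ey (\<gamma> ij)) (Q ij)"
    and "\<exists>g :: real \<times> real \<Rightarrow> real.
           continuous_on ({x 0..x n} \<times> {y 0..y m}) g \<and>
           (\<forall>i\<in>{0..n}. \<forall>j\<in>{0..m}. g (x i, y j) = z i j) \<and>
           (\<forall>ij\<in>idx n m. let k = \<gamma> ij in
              (\<forall>\<alpha>\<in>{sx k, ex k}. \<forall>v\<in>{y (sy k)..y (ey k)}.
                 F_map Lx Ly S Q ij (x \<alpha>, v, g (x \<alpha>, v)) = g (L_map Lx Ly ij (x \<alpha>, v))) \<and>
              (\<forall>\<beta>\<in>{sy k, ey k}. \<forall>u\<in>{x (sx k)..x (ex k)}.
                 F_map Lx Ly S Q ij (u, y \<beta>, g (u, y \<beta>)) = g (L_map Lx Ly ij (u, y \<beta>))))"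
    and "irreducible_matrix (n * m)
           (transition_matrix n m (region x y) (\<lambda>ij. domain_rect x y sx ex sy ey (\<gamma> ij)))"
  shows "\<exists>f :: real \<times> real \<Rightarrow> real.
           (\<forall>i\<in>{0..n}. \<forall>j\<in>{0..m}. f (x i, y j) = z i j) \<and>
           {(u, v, f (u, v)) | u v. (u, v) \<in> {x 0..x n} \<times> {y 0..y m}} =
             attractor n m (region x y)
               (transition_matrix n m (region x y) (\<lambda>ij. domain_rect x y sx ex sy ey (\<gamma> ij)))
               (W_map Lx Ly S Q)"
proof -
  define D where "D ij = domain_rect x y sx ex sy ey (\<gamma> ij)" for ij
  define E where "E = region x y"
  define L where "L = L_map Lx Ly"
  define X where "X = {x 0..x n} \<times> {y 0..y m}"
  define \<Gamma> where "\<Gamma> = {p. fst p \<in> x ` {0..n} \<or> snd p \<in> y ` {0..m}}"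
  \<comment> \<open>As \<open>l \<ge> 2\<close>, there is a domain with index 1; it spans at least
    two cells in each direction.\<close>
  have nm: "0 < n" "0 < m"
    using bspec[OF assms(4), of 1] assms(3) by auto
  have \<gamma>: "sx (\<gamma> a) < ex (\<gamma> a)" "ex (\<gamma> a) \<le> n" "sy (\<gamma> a) < ey (\<gamma> a)" "ey (\<gamma> a) \<le> m"
    if "a \<in> idx n m" for a
    using bspec[OF assms(4), of "\<gamma> a"] assms(5) that by (auto simp: Pi_iff)
  have E_sub: "E (i, j) \<subseteq> {x a..x b} \<times> {y c..y d}"
    if "a < i" "i \<le> b" "b \<le> n" "c < j" "j \<le> d" "d \<le> m" for a b c d i j
  proof -
    have "x a \<le> x (i - 1)" "x i \<le> x b" using that by (auto intro!: grid_mono[OF assms(1)])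
    moreover have "y c \<le> y (j - 1)" "y j \<le> y d" using that by (auto intro!: grid_mono[OF assms(2)])
    ultimately show ?thesis by (auto simp: E_def region_def)
  qed
  \<comment> \<open>Stated for arbitrary grid rectangles so that it serves both the full rectangle
    \<open>X\<close> and each domain \<open>D a\<close>.\<close>
  have E_cover: "\<exists>ij\<in>idx n m. q \<in> E ij \<and> E ij \<subseteq> {x a..x b} \<times> {y c..y d}"
    if ab: "a < b" "b \<le> n" and cd: "c < d" "d \<le> m" and q: "q \<in> {x a..x b} \<times> {y c..y d}"
    for a b c d q
  proof -
    obtain i where i: "a < i" "i \<le> b" "fst q \<in> {x (i - 1)..x i}"
      using grid_cell[OF assms(1) ab, of "fst q"] q by auto
    obtain j where j: "c < j" "j \<le> d" "snd q \<in> {y (j - 1)..y j}"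
      using grid_cell[OF assms(2) cd, of "snd q"] q by auto
    have "(i, j) \<in> idx n m" using i j ab cd by (simp add: idx_def)
    moreover have "q \<in> E (i, j)" using i(3) j(3) by (cases q) (simp add: E_def region_def)
    ultimately show ?thesis using E_sub[OF i(1,2) ab(2) j(1,2) cd(2)] by blast
  qed
  have X_eq: "X = (\<Union>a\<in>idx n m. E a)"
  proof
    show "X \<subseteq> (\<Union>a\<in>idx n m. E a)"
      using E_cover[OF nm(1) order_refl nm(2) order_refl] unfolding X_def by blast
    show "(\<Union>a\<in>idx n m. E a) \<subseteq> X"
    proof (rule UN_least)
      fix a assume "a \<in> idx n m"
      then show "E a \<subseteq> X"
        using E_sub[of 0 "fst a" n 0 "snd a" m] by (cases a) (simp add: X_def idx_def)
    qed
  qed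
  have D_X: "D a \<subseteq> X" if "a \<in> idx n m" for a
  proof -
    have "x 0 \<le> x (sx (\<gamma> a))" "x (ex (\<gamma> a)) \<le> x n" "y 0 \<le> y (sy (\<gamma> a))" "y (ey (\<gamma> a)) \<le> y m"
      using \<gamma>[OF that] by (auto intro!: grid_mono[OF assms(1)] grid_mono[OF assms(2)])
    then show ?thesis by (auto simp: D_def domain_rect_def X_def)
  qed
  have E_compact: "compact (E a)" for a
    by (cases a) (simp add: E_def region_def compact_Times)
  have E_ne: "E a \<noteq> {}" if "a \<in> idx n m" for a
  proof -
    have "x (fst a - 1) \<le> x (fst a)" "y (snd a - 1) \<le> y (snd a)"
      using that by (auto simp: idx_def intro!: grid_mono[OF assms(1)] grid_mono[OF assms(2)])
    then show ?thesis by (auto simp: E_def region_def case_prod_beta)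
  qed
  have Lx: "contraction_homeomorphism {x (sx (\<gamma> a))..x (ex (\<gamma> a))} {x (fst a - 1)..x (fst a)} (Lx a)"
      "Lx a ` {x (sx (\<gamma> a)), x (ex (\<gamma> a))} = {x (fst a - 1), x (fst a)}"
    and Ly: "contraction_homeomorphism {y (sy (\<gamma> a))..y (ey (\<gamma> a))} {y (snd a - 1)..y (snd a)} (Ly a)"
      "Ly a ` {y (sy (\<gamma> a)), y (ey (\<gamma> a))} = {y (snd a - 1), y (snd a)}" if "a \<in> idx n m" for a
    using bspec[OF assms(6) that] by (simp_all add: case_prod_beta Let_def)
  have D_eq: "D a = {x (sx (\<gamma> a))..x (ex (\<gamma> a))} \<times> {y (sy (\<gamma> a))..y (ey (\<gamma> a))}" for a
    by (simp add: D_def domain_rect_def)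
  have E_eq: "E a = {x (fst a - 1)..x (fst a)} \<times> {y (snd a - 1)..y (snd a)}" for a
    by (simp add: E_def region_def case_prod_beta)
  have L_contr: "contraction_on (D a) (L a)" if "a \<in> idx n m" for a
    unfolding L_def D_eq using Lx(1)[OF that] Ly(1)[OF that]
    by (intro contraction_on_L_map) (simp_all add: contraction_homeomorphism_def)
  have "\<exists>h. homeomorphism (D a) (E a) (L a) h" if "a \<in> idx n m" for a
    unfolding L_def D_eq E_eq using Lx(1)[OF that] Ly(1)[OF that]
    unfolding contraction_homeomorphism_def by (blast intro: homeomorphism_L_map)
  then obtain R where R: "\<And>a. a \<in> idx n m \<Longrightarrow> homeomorphism (D a) (E a) (L a) (R a)"
    by metis
  obtain \<rho> where \<rho>: "\<rho> < 1" "\<And>a p. a \<in> idx n m \<Longrightarrow> p \<in> E a \<Longrightarrow> \<bar>S a p\<bar> \<le> \<rho>"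
    using assms(8) unfolding E_def by blast
  \<comment> \<open>The assumption bounds \<rho> only from above; a point of the nonempty region
    \<open>(1, 1)\<close> gives 0 \<le> \<rho>.\<close>
  have "(1, 1) \<in> idx n m" using nm by (simp add: idx_def)
  then have \<rho>_nonneg: "0 \<le> \<rho>" using \<rho>(2)[of "(1, 1)"] E_ne[of "(1, 1)"] abs_ge_zero order_trans by blast
  obtain g where g: "continuous_on X g" "\<And>i j. i \<le> n \<Longrightarrow> j \<le> m \<Longrightarrow> g (x i, y j) = z i j"
    and g_x: "\<And>a \<alpha> v. a \<in> idx n m \<Longrightarrow> \<alpha> \<in> {sx (\<gamma> a), ex (\<gamma> a)} \<Longrightarrow> v \<in> {y (sy (\<gamma> a))..y (ey (\<gamma> a))} \<Longrightarrow>
        F_map Lx Ly S Q a (x \<alpha>, v, g (x \<alpha>, v)) = g (L a (x \<alpha>, v))"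
    and g_y: "\<And>a \<beta> u. a \<in> idx n m \<Longrightarrow> \<beta> \<in> {sy (\<gamma> a), ey (\<gamma> a)} \<Longrightarrow> u \<in> {x (sx (\<gamma> a))..x (ex (\<gamma> a))} \<Longrightarrow>
        F_map Lx Ly S Q a (u, y \<beta>, g (u, y \<beta>)) = g (L a (u, y \<beta>))"
    using assms(10) unfolding X_def[symmetric] L_def[symmetric] Let_def by fastforce
  \<comment> \<open>Distinct regions differ in their column or their row, and the corresponding
    coordinate of a common point is then a grid value.\<close>
  have overlap: "E a \<inter> E b \<subseteq> \<Gamma>" if "a \<in> idx n m" "b \<in> idx n m" "a \<noteq> b" for a b
  proof
    fix p assume p: "p \<in> E a \<inter> E b"
    have "fst a \<noteq> fst b \<or> snd a \<noteq> snd b" using that(3) by (simp add: prod_eq_iff)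
    then show "p \<in> \<Gamma>"
    proof
      assume "fst a \<noteq> fst b"
      then have "fst p \<in> x ` {0..n}"
        using that p by (intro grid_cells_overlap[OF assms(1), of "fst a" "fst b"]) (auto simp: idx_def E_eq)
      then show ?thesis by (simp add: \<Gamma>_def)
    next
      assume "snd a \<noteq> snd b"
      then have "snd p \<in> y ` {0..m}"
        using that p by (intro grid_cells_overlap[OF assms(2), of "snd a" "snd b"]) (auto simp: idx_def E_eq)
      then show ?thesis by (simp add: \<Gamma>_def)
    qed
  qed
  \<comment> \<open>Injectivity of \<open>h\<close>: every point of \<open>V\<close> already has its
    preimage in \<open>U\<close>. It is applied with the endpoint pairs of a domain interval and of
    its image cell.\<close>
  have endpoint: "u \<in> U" if "homeomorphism A B h k" "h ` U = V" "h u \<in> V" "u \<in> A" "U \<subseteq> A"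
    for A B U V :: "real set" and h k u
    using that by (metis homeomorphism_apply1 imageE subsetD)
  \<comment> \<open>If \<open>L a q\<close> lies on a grid line, one of its coordinates is a grid
    value inside a cell, hence an endpoint of the cell. So \<open>q\<close> is on the boundary of
    its domain, where condition (A) or (B) is the required equation.\<close>
  have compat: "q \<in> \<Gamma> \<and> S a (L a q) * g q + Q a q = g (L a q)"
    if a: "a \<in> idx n m" and q: "q \<in> D a" and Lq: "L a q \<in> \<Gamma>" for a q
  proof -
    obtain u v where uv: "q = (u, v)" by fastforce
    have u: "u \<in> {x (sx (\<gamma> a))..x (ex (\<gamma> a))}" and v: "v \<in> {y (sy (\<gamma> a))..y (ey (\<gamma> a))}"
      using q by (auto simp: D_eq uv)
    have F: "F_map Lx Ly S Q a (u, v, w) = S a (L a q) * w + Q a q" for w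
      by (simp add: F_map_def L_def uv)
    have "L a q \<in> E a" using R[OF a] q by (auto simp: homeomorphism_def)
    then have Lu: "Lx a u \<in> {x (fst a - 1)..x (fst a)}" and Lv: "Ly a v \<in> {y (snd a - 1)..y (snd a)}"
      by (auto simp: E_eq L_def L_map_def uv)
    have a': "fst a \<in> {1..n}" "snd a \<in> {1..m}" using a by (auto simp: idx_def)
    have x_le: "x (sx (\<gamma> a)) \<le> x (ex (\<gamma> a))" and y_le: "y (sy (\<gamma> a)) \<le> y (ey (\<gamma> a))"
      using u v by auto
    consider "Lx a u \<in> x ` {0..n}" | "Ly a v \<in> y ` {0..m}"
      using Lq by (auto simp: \<Gamma>_def L_def L_map_def uv)
    then show ?thesis
    proof cases
      case 1
      then have "Lx a u \<in> {x (fst a - 1), x (fst a)}"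
        by (rule grid_point_in_cell[OF assms(1) a'(1) _ Lu])
      moreover obtain h where "homeomorphism {x (sx (\<gamma> a))..x (ex (\<gamma> a))} {x (fst a - 1)..x (fst a)} (Lx a) h"
        using Lx(1)[OF a] unfolding contraction_homeomorphism_def by blast
      ultimately have "u \<in> {x (sx (\<gamma> a)), x (ex (\<gamma> a))}"
        using endpoint[OF _ Lx(2)[OF a] _ u] x_le by auto
      then obtain \<alpha> where \<alpha>: "\<alpha> \<in> {sx (\<gamma> a), ex (\<gamma> a)}" "u = x \<alpha>" by blast
      then have "\<alpha> \<le> n" using \<gamma>[OF a] by auto
      then show ?thesis using g_x[OF a \<alpha>(1) v] F \<alpha>(2) by (auto simp: \<Gamma>_def uv)
    next
      case 2
      then have "Ly a v \<in> {y (snd a - 1), y (snd a)}"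
        by (rule grid_point_in_cell[OF assms(2) a'(2) _ Lv])
      moreover obtain h where "homeomorphism {y (sy (\<gamma> a))..y (ey (\<gamma> a))} {y (snd a - 1)..y (snd a)} (Ly a) h"
        using Ly(1)[OF a] unfolding contraction_homeomorphism_def by blast
      ultimately have "v \<in> {y (sy (\<gamma> a)), y (ey (\<gamma> a))}"
        using endpoint[OF _ Ly(2)[OF a] _ v] y_le by auto
      then obtain \<beta> where \<beta>: "\<beta> \<in> {sy (\<gamma> a), ey (\<gamma> a)}" "v = y \<beta>" by blast
      then have "\<beta> \<le> m" using \<gamma>[OF a] by auto
      then show ?thesis using g_y[OF a \<beta>(1) u] F \<beta>(2) by (auto simp: \<Gamma>_def uv)
    qed
  qed
  have S_cont: "continuous_on (E a) (S a)" if "a \<in> idx n m" for a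
    using assms(7) that lipschitz_on_continuous_on unfolding contraction_on_def E_def by blast
  have Q_cont: "continuous_on (D a) (Q a)" if "a \<in> idx n m" for a
    using assms(9) that lipschitz_on_continuous_on unfolding D_def by blast
  have "finite (idx n m)" by (simp add: idx_def)
  from fractal_function_exists[OF this X_eq E_compact D_X R S_cont \<rho>(2) \<rho>_nonneg \<rho>(1) Q_cont g(1) overlap compat]
  obtain f where f: "continuous_on X f" "\<And>p. p \<in> X \<inter> \<Gamma> \<Longrightarrow> f p = g p"
    and f_eq: "\<And>a q. a \<in> idx n m \<Longrightarrow> q \<in> D a \<Longrightarrow> f (L a q) = S a (L a q) * f q + Q a q"
    by blast
  define G where "G s = (\<lambda>p. (fst p, snd p, f p)) ` E (tau_inv n m s)" for s
  let ?inv = "invariant_tuple n m E (transition_matrix n m E D) (W_map Lx Ly S Q)"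
  have inv_iff: "?inv A \<longleftrightarrow> (\<forall>s\<in>{1..n * m}. A s = G s)" for A
    unfolding G_def
  proof (rule invariant_tuple_iff_graph[where \<rho> = \<rho>])
    fix a assume a: "a \<in> idx n m"
    show "L_map Lx Ly a ` D a = E a"
      using R[OF a] unfolding L_def by (simp add: homeomorphism_def)
    show "continuous_on (E a) f"
      using a by (intro continuous_on_subset[OF f(1)]) (auto simp: X_eq)
    fix q assume "q \<in> D a"
    then show "\<exists>b\<in>idx n m. q \<in> E b \<and> E b \<subseteq> D a"
      unfolding D_eq by (rule E_cover[OF \<gamma>[OF a]])
  qed (use E_compact E_ne L_contr f_eq \<rho> \<rho>_nonneg in \<open>simp_all add: L_def\<close>)
  \<comment> \<open>\<open>inv_iff\<close> fixes a tuple on the index range and extensionality fixes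
    it elsewhere, which leaves exactly \<open>restrict G {1..n * m}\<close>.\<close>
  have "(THE A. A \<in> extensional {1..n * m} \<and> ?inv A) = restrict G {1..n * m}"
  proof (rule the_equality)
    show "restrict G {1..n * m} \<in> extensional {1..n * m} \<and> ?inv (restrict G {1..n * m})"
      by (simp add: inv_iff)
    show "A = restrict G {1..n * m}" if "A \<in> extensional {1..n * m} \<and> ?inv A" for A
      using that by (intro extensionalityI[of A "{1..n * m}"]) (simp_all add: inv_iff)
  qed
  then have "attractor n m E (transition_matrix n m E D) (W_map Lx Ly S Q) = (\<Union>s\<in>{1..n * m}. G s)"
    by (simp add: attractor_def)
  also have "\<dots> = (\<lambda>p. (fst p, snd p, f p)) ` (\<Union>a\<in>tau_inv n m ` {1..n * m}. E a)"
    by (auto simp: G_def)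
  also have "\<dots> = {(u, v, f (u, v)) | u v. (u, v) \<in> X}"
    unfolding bij_betw_imp_surj_on[OF bij_betw_tau_inv] X_eq[symmetric] by force
  finally have "{(u, v, f (u, v)) | u v. (u, v) \<in> X} =
      attractor n m E (transition_matrix n m E D) (W_map Lx Ly S Q)" by simp
  \<comment> \<open>Grid nodes lie in \<Gamma>, where \<open>f\<close> agrees with the interpolating
    function \<open>g\<close>.\<close>
  moreover have "f (x i, y j) = z i j" if "i \<le> n" "j \<le> m" for i j
  proof -
    have "(x i, y j) \<in> X \<inter> \<Gamma>"
      using that by (auto simp: X_def \<Gamma>_def intro!: grid_mono[OF assms(1)] grid_mono[OF assms(2)])
    then show ?thesis using f(2) g(2)[OF that] by simp
  qed
  ultimately show ?thesis
    unfolding X_def E_def D_def by (intro exI[of _ f]) auto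
qed

end
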